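(* Let $P=\operatorname{conv}(X)$ with $X\subseteq\{0,1\}^d$ a nonempty set (for some $d\geq 1$) be a 0/1-polytope whose dimension is at most five, and let $\mathcal{G}(P)$ be its graph. Then $\mathcal{X}(\mathcal{G}(P))\geq 1$, i.e., the graph of $P$ has edge expansion at least one.
   Context: A 0/1-polytope is the convex hull of a set of points with all coordinates in $\{0,1\}$; its vertices are exactly these points. Its dimension is the dimension of its affine hull. The graph $\mathcal{G}(P)$ of a polytope $P$ has the vertices of $P$ as nodes, two of them being adjacent iff the segment joining them is a one-dimensional face of $P$. For a finite graph $H=(V,E)$ the edge expansion is $$\mathcal{X}(H)=\min\left\{\frac{|\delta(S)|}{|S|} : S\subset V,\ S\neq\emptyset,\ |S|\leq\frac{|V|}{2}\right\},$$ where $\delta(S)$ is the set of edges with one end node in $S$ and the other in $V\setminus S$. If $|V|\leq 1$ the minimum is over the empty set and is regarded as $+\infty$. *)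

theory Defs
  imports "HOL-Analysis.Analysis"
begin

definition zero_one_cube :: "(real ^ 'd) set"
  where "zero_one_cube = {x. \<forall>i. x $ i \<in> {0, 1}}"

(* Undirected simple graphs; an edge is the two-element set of its end nodes. *)
record 'v ugraph =
  nodes :: "'v set"
  edges :: "'v set set"

definition polytope_graph :: "'a::euclidean_space set \<Rightarrow> 'a ugraph"
  where "polytope_graph P =
    \<lparr>nodes = {v. v extreme_point_of P},
     edges = {{u, v} | u v. u extreme_point_of P \<and> v extreme_point_of P \<and> u \<noteq> v \<and>
                            closed_segment u v edge_of P}\<rparr>"

definition edge_cut :: "'v ugraph \<Rightarrow> 'v set \<Rightarrow> 'v set set"
  where "edge_cut H S = {e \<in> edges H. \<exists>u \<in> S. \<exists>v \<in> nodes H - S. e = {u, v}}"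

definition expansion_candidates :: "'v ugraph \<Rightarrow> 'v set set"
  where "expansion_candidates H =
    {S. S \<subset> nodes H \<and> S \<noteq> {} \<and> real (card S) \<le> real (card (nodes H)) / 2}"

(* Meant for finite graphs, where the infimum is a minimum, or Inf {} = \<infinity> when there
   is at most one node; see the two lemmas below. *)
definition edge_expansion :: "'v ugraph \<Rightarrow> ereal"
  where "edge_expansion H =
    (INF S \<in> expansion_candidates H. ereal (real (card (edge_cut H S)) / real (card S)))"

lemma edge_expansion_eq_Min:
  assumes "finite (nodes H)" and "expansion_candidates H \<noteq> {}"
  shows "edge_expansion H =
    Min ((\<lambda>S. ereal (real (card (edge_cut H S)) / real (card S))) ` expansion_candidates H)"
proof -
  have "expansion_candidates H \<subseteq> Pow (nodes H)"
    by (auto simp: expansion_candidates_def)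
  then have "finite (expansion_candidates H)"
    using assms(1) by (meson finite_Pow_iff finite_subset)
  then show ?thesis
    using assms(2) unfolding edge_expansion_def by (simp add: Min_Inf)
qed

lemma edge_expansion_at_most_one_node:
  assumes "finite (nodes H)" and "card (nodes H) \<le> 1"
  shows "edge_expansion H = \<infinity>"
proof -
  have "S \<notin> expansion_candidates H" for S
  proof
    assume S: "S \<in> expansion_candidates H"
    then have "finite S"
      using assms(1) by (auto simp: expansion_candidates_def intro: finite_subset)
    then have "card S \<ge> 1"
      using S by (simp add: expansion_candidates_def card_gt_0_iff Suc_le_eq)
    moreover have "real (card S) \<le> 1 / 2"
      using S assms(2) by (simp add: expansion_candidates_def)
    ultimately show False by linarith
  qed
  then have "expansion_candidates H = {}" by blast
  then show ?thesis by (simp add: edge_expansion_def top_ereal_def)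
qed

end

theory Submission
  imports Defs
begin

text \<open>
  The only property of the graph that is used is this: if two vertices $u$, $w$ differ in
  coordinate $j$, then $u$ has a neighbour that lies coordinatewise between $u$ and $w$ and differs
  from $u$ in $j$ (an edge at $u$ of the smallest cube face containing $u$ and $w$ that leaves the
  hyperplane $x_j = u_j$). Five suitable coordinates separate the vertices.

  Induction on the number of separating coordinates shows that a partition of the vertices into
  nonempty $S$, $T$ cuts at least $\min(|S|,|T|)$ edges, and one more if $|S| \neq |T|$ and there
  are at most four coordinates. Splitting along a coordinate into two faces, only the case
  where $S$ has the majority $S_0$ of one face and $T$ the majority $T_1$ of the other is not
  settled by the two faces alone. Let $A \subseteq S_0$ and $B \subseteq T_1$ be the vertices
  without cut edges across. All neighbours across of $A$ lie in $S_1$ and those of $B$ in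
  $T_0$; so, projected to the remaining at most four coordinates, $S_1$ and $T_0$ both meet every
  interval between $A$ and $B$, which prevents $A$ and $B$ from both being large.
\<close>

section \<open>Intervals of the cube and families that block them\<close>

text \<open>Points of the cube are encoded as sets of coordinates; this is the vertex set of the
  smallest cube face containing \<open>x\<close> and \<open>y\<close>.\<close>

definition interval :: "'j set \<Rightarrow> 'j set \<Rightarrow> 'j set set"
  where "interval x y = {z. x \<inter> y \<subseteq> z \<and> z \<subseteq> x \<union> y}"

definition half :: "'j \<Rightarrow> bool \<Rightarrow> 'j set set \<Rightarrow> 'j set set"
  where "half j b F = {x \<in> F. (j \<in> x) = b}"

text \<open>Because of the two disjointness conditions, the point of \<open>C\<close> in an interval
  always differs from both ends of that interval.\<close>

definition blocks :: "'j set set \<Rightarrow> 'j set set \<Rightarrow> 'j set set \<Rightarrow> bool"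
  where "blocks C U B \<longleftrightarrow>
    C \<inter> U = {} \<and> C \<inter> B = {} \<and> (\<forall>u\<in>U. \<forall>w\<in>B. interval u w \<inter> C \<noteq> {})"

lemma finite_if_inj_on_trace:
  assumes "finite K" and "inj_on (\<lambda>x. x \<inter> K) F"
  shows "finite F"
proof -
  have "(\<lambda>x. x \<inter> K) ` F \<subseteq> Pow K" by auto
  then show ?thesis
    using assms finite_imageD finite_subset finite_Pow_iff by metis
qed

lemma card_halves:
  assumes "finite F"
  shows "card F = card (half j True F) + card (half j False F)"
proof -
  have "F = half j True F \<union> half j False F" "half j True F \<inter> half j False F = {}"
    by (auto simp: half_def)
  moreover have "finite (half j True F)" "finite (half j False F)"
    using assms by (auto simp: half_def)
  ultimately show ?thesis using card_Un_disjoint by metis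
qed

lemma inj_on_trace_half:
  assumes "inj_on (\<lambda>x. x \<inter> K) F"
  shows "inj_on (\<lambda>x. x \<inter> (K - {j})) (half j b F)"
proof (rule inj_onI)
  fix x y assume *: "x \<in> half j b F" "y \<in> half j b F" "x \<inter> (K - {j}) = y \<inter> (K - {j})"
  then have "x \<inter> K = y \<inter> K" by (auto simp: half_def)
  with * assms show "x = y" by (auto simp: half_def inj_on_def)
qed

lemma half_Un: "half j b (F \<union> G) = half j b F \<union> half j b G"
  by (auto simp: half_def)

lemma blocks_half:
  assumes "blocks C U B"
  shows "blocks (half j b C) (half j b U) (half j b B)"
  unfolding blocks_def
proof (intro conjI ballI)
  fix u w assume u: "u \<in> half j b U" and w: "w \<in> half j b B"
  then obtain c where c: "c \<in> C" "c \<in> interval u w"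
    using assms by (fastforce simp: blocks_def half_def)
  then have "c \<in> half j b C"
    using u w by (auto simp: half_def interval_def)
  with c show "interval u w \<inter> half j b C \<noteq> {}" by blast
qed (use assms in \<open>auto simp: blocks_def half_def\<close>)

text \<open>This is the blocking situation seen from a point of \<open>U\<close> that has been moved
  to the empty set, so that intervals become power sets. As \<open>{} \<notin> C\<close>, every
  member of \<open>B\<close> has at least two elements, and \<open>B\<close> is empty if
  \<open>C\<close> is.\<close>

lemma card_le_card_proper_subsets:
  assumes K: "finite K" and B: "B \<subseteq> Pow K" and C: "C \<subseteq> Pow K" "{} \<notin> C"
    and sub: "\<And>w. w \<in> B \<Longrightarrow> \<exists>c\<in>C. c \<subset> w"
  shows "card K \<le> 2 \<Longrightarrow> card B \<le> card C"
    and "card K \<le> 3 \<Longrightarrow> card B \<le> card C + 2"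
proof -
  have finB: "finite B" and finC: "finite C"
    using K B C by (auto intro: finite_subset)
  have empty: "card B = 0" if "card C = 0"
    using that finC sub by fastforce
  have two: "2 \<le> card w" if w: "w \<in> B" for w
  proof -
    from sub[OF w] obtain c where c: "c \<in> C" "c \<subset> w" by blast
    have "finite w" using w B K by (auto intro: finite_subset)
    then have "card c < card w" "0 < card c"
      using c C by (auto intro: psubset_card_mono simp: card_gt_0_iff finite_subset)
    then show ?thesis by linarith
  qed
  show "card B \<le> card C" if "card K \<le> 2"
  proof -
    have "w = K" if "w \<in> B" for w
      using two[OF that] that B K \<open>card K \<le> 2\<close>
      by (metis PowD card_seteq le_trans subsetD)
    then have "B \<subseteq> {K}" by blast
    then have "card B \<le> 1" using card_mono[of "{K}" B] by simp
    with empty show ?thesis by linarith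
  qed
  show "card B \<le> card C + 2" if K3: "card K \<le> 3"
  proof -
    consider "card C = 0" | "card C = 1" | "2 \<le> card C" by linarith
    then show ?thesis
    proof cases
      case 1
      with empty show ?thesis by simp
    next
      case 2
      then obtain c where c: "C = {c}" by (auto simp: card_1_singleton_iff)
      have fc: "finite c" "c \<subseteq> K" "c \<noteq> {}"
        using c C K by (auto intro: finite_subset)
      \<comment> \<open>Every member of \<open>B\<close> is a proper superset of the nonempty set
        \<open>c\<close>. Within three coordinates there are at most \<open>2 ^ 2 - 1\<close> of
        these, which is exactly \<open>card C + 2\<close>.\<close>
      have "B \<subseteq> (\<lambda>y. c \<union> y) ` (Pow (K - c) - {{}})"
      proof
        fix w assume w: "w \<in> B"
        then have "c \<subset> w" "w \<subseteq> K" using sub c B by auto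
        then have "w = c \<union> (w - c)" "w - c \<in> Pow (K - c) - {{}}" by auto
        then show "w \<in> (\<lambda>y. c \<union> y) ` (Pow (K - c) - {{}})" by blast
      qed
      then have "card B \<le> card (Pow (K - c) - {{}})"
        using K by (meson finite_Diff finite_Pow_iff surj_card_le)
      also have "\<dots> = 2 ^ card (K - c) - 1"
        using K by (subst card_Diff_subset) (auto simp: card_Pow)
      also have "\<dots> \<le> 2 ^ 2 - 1"
      proof -
        have "0 < card c" using fc by (simp add: card_gt_0_iff)
        then have "card (K - c) \<le> 2" using fc K3 by (simp add: card_Diff_subset)
        then have "(2::nat) ^ card (K - c) \<le> 2 ^ 2" by (intro power_increasing) auto
        then show ?thesis by linarith
      qed
      finally show ?thesis using 2 by simp
    next
      case 3
      \<comment> \<open>A subset of \<open>K\<close> with at least two elements omits at most one of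
        the at most three coordinates. This leaves at most four sets, and \<open>card C + 2\<close>
        is at least four here.\<close>
      have "B \<subseteq> insert K ((\<lambda>k. K - {k}) ` K)"
      proof
        fix w assume w: "w \<in> B"
        then have wK: "w \<subseteq> K" using B by auto
        show "w \<in> insert K ((\<lambda>k. K - {k}) ` K)"
        proof (cases "w = K")
          case False
          then obtain k where k: "k \<in> K" "k \<notin> w" using wK by blast
          then have "w \<subseteq> K - {k}" using wK by blast
          moreover have "card (K - {k}) \<le> card w"
            using two[OF w] K3 k K by simp
          ultimately have "w = K - {k}" using K by (simp add: card_seteq)
          with k show ?thesis by blast
        qed simp
      qed
      then have "card B \<le> card (insert K ((\<lambda>k. K - {k}) ` K))"
        using K by (intro card_mono) auto
      also have "\<dots> \<le> Suc (card ((\<lambda>k. K - {k}) ` K))"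
        by (rule card_insert_le_m1) auto
      also have "\<dots> \<le> 4"
        using card_image_le[OF K, of "\<lambda>k. K - {k}"] K3 by linarith
      finally show ?thesis using 3 by linarith
    qed
  qed
qed

text \<open>Reflecting the cube at \<open>u\<close>, which is what \<open>f\<close> does on
  \<open>K\<close>, sends \<open>u\<close> to the empty set and the interval from \<open>u\<close>
  to \<open>b\<close> into the subsets of \<open>f b\<close>. Blocking then says that
  \<open>f b\<close> has a proper nonempty subset in the image of \<open>C\<close>.\<close>

lemma blocks_card_1:
  assumes K: "finite K" and inj: "inj_on (\<lambda>x. x \<inter> K) (U \<union> B \<union> C)"
    and blk: "blocks C U B" and u: "u \<in> U"
  shows "card K \<le> 2 \<Longrightarrow> card B \<le> card C"
    and "card K \<le> 3 \<Longrightarrow> card B \<le> card C + 2"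
proof -
  define f where "f x = {j \<in> K. (j \<in> x) \<noteq> (j \<in> u)}" for x
  have f_eq: "x = y" if "f x = f y" "x \<in> U \<union> B \<union> C" "y \<in> U \<union> B \<union> C" for x y
  proof -
    have "x \<inter> K = y \<inter> K" using that(1) by (auto simp: f_def set_eq_iff)
    with that inj show ?thesis by (auto simp: inj_on_def)
  qed
  then have injf: "inj_on f B" "inj_on f C" by (auto simp: inj_on_def)
  have cards: "card (f ` B) = card B" "card (f ` C) = card C"
    using injf by (auto simp: card_image)
  have "f u = {}" by (auto simp: f_def)
  then have nonempty: "{} \<notin> f ` C"
    using f_eq u blk by (auto simp: blocks_def) (metis UnCI disjoint_iff)
  have sub: "\<exists>c\<in>f ` C. c \<subset> w" if w: "w \<in> f ` B" for w
  proof -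
    from w obtain b where b: "b \<in> B" "w = f b" by blast
    then obtain c where c: "c \<in> C" "c \<in> interval u b"
      using blk u by (fastforce simp: blocks_def)
    have "f c \<subseteq> f b" using c by (auto simp: f_def interval_def)
    moreover have "f c \<noteq> f b"
      using f_eq[of c b] b c blk by (auto simp: blocks_def)
    ultimately show ?thesis using b c by blast
  qed
  have "f ` B \<subseteq> Pow K" "f ` C \<subseteq> Pow K" by (auto simp: f_def)
  note card_le_card_proper_subsets[OF K this nonempty sub]
  then show "card K \<le> 2 \<Longrightarrow> card B \<le> card C"
    and "card K \<le> 3 \<Longrightarrow> card B \<le> card C + 2"
    by (simp_all add: cards)
qed

lemma separating_coordinate:
  assumes "inj_on (\<lambda>x. x \<inter> K) F" "x \<in> F" "y \<in> F" "x \<noteq> y"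
  obtains j where "j \<in> K" "j \<in> x \<longleftrightarrow> j \<notin> y"
  using assms by (auto simp: inj_on_def)

text \<open>A coordinate that separates two points of \<open>U\<close> leaves one of them in each
  half. With at most two coordinates remaining, neither half incurs a loss.\<close>

lemma blocks_card_2:
  assumes K: "finite K" "card K \<le> 3" and inj: "inj_on (\<lambda>x. x \<inter> K) (U \<union> B \<union> C)"
    and blk: "blocks C U B" and u: "u \<in> U" "v \<in> U" "u \<noteq> v"
  shows "card B \<le> card C"
proof -
  obtain j where j: "j \<in> K" "j \<in> u \<longleftrightarrow> j \<notin> v"
    using separating_coordinate[OF inj, of u v] u by blast
  have *: "card (half j b B) \<le> card (half j b C)" for b
  proof -
    have "\<exists>x. x \<in> half j b U" using u j by (cases b) (auto simp: half_def)
    then obtain x where "x \<in> half j b U" by blast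
    moreover have "inj_on (\<lambda>x. x \<inter> (K - {j})) (half j b U \<union> half j b B \<union> half j b C)"
      using inj_on_trace_half[OF inj] by (simp add: half_Un)
    moreover have "card (K - {j}) \<le> 2" using K j by simp
    ultimately show ?thesis
      using blocks_card_1(1)[of "K - {j}"] blocks_half[OF blk] K by blast
  qed
  have "finite B" "finite C" using finite_if_inj_on_trace[OF K(1) inj] by auto
  then show ?thesis
    using *[of True] *[of False] card_halves[of B j] card_halves[of C j] by linarith
qed

text \<open>A coordinate that separates two of three points of \<open>U\<close> leaves two points in
  one half and one in the other. The half with two points, where \<open>w\<close> lies, has no loss;
  the other one accounts for the summand 2.\<close>

lemma blocks_card_3:
  assumes K: "finite K" "card K \<le> 4" and inj: "inj_on (\<lambda>x. x \<inter> K) (U \<union> B \<union> C)"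
    and blk: "blocks C U B" and U: "3 \<le> card U"
  shows "card B \<le> card C + 2"
proof -
  obtain u v w where u: "u \<in> U" "v \<in> U" "w \<in> U" and ne: "u \<noteq> v" "u \<noteq> w" "v \<noteq> w"
    using U by (auto simp: card_le_Suc_iff numeral_3_eq_3)
  obtain j where j: "j \<in> K" "j \<in> u \<longleftrightarrow> j \<notin> v"
    using separating_coordinate[OF inj, of u v] u ne by blast
  have K': "finite (K - {j})" "card (K - {j}) \<le> 3" using K j by auto
  have inj': "inj_on (\<lambda>x. x \<inter> (K - {j})) (half j b U \<union> half j b B \<union> half j b C)" for b
    using inj_on_trace_half[OF inj] by (simp add: half_Un)
  define b where "b = (j \<in> w)"
  have "\<exists>x. x \<in> half j (\<not> b) U"
    using u j by (auto simp: half_def b_def)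
  then have 1: "card (half j (\<not> b) B) \<le> card (half j (\<not> b) C) + 2"
    using blocks_card_1(2)[OF K'(1) inj' blocks_half[OF blk]] K' by blast
  have "\<exists>x \<in> half j b U. \<exists>y \<in> half j b U. x \<noteq> y"
    using u j ne by (auto simp: half_def b_def)
  then have 2: "card (half j b B) \<le> card (half j b C)"
    using blocks_card_2[OF K' inj' blocks_half[OF blk]] by blast
  have "finite B" "finite C" using finite_if_inj_on_trace[OF K(1) inj] by auto
  then show ?thesis
    using 1 2 card_halves[of B j] card_halves[of C j] by (cases b) auto
qed

lemma blocks_card:
  assumes K: "finite K" "card K \<le> m + 1" and m: "m = 2 \<or> m = 3"
    and inj: "inj_on (\<lambda>x. x \<inter> K) (U \<union> B \<union> C)"
    and blk: "blocks C U B" and U: "m \<le> card U"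
  shows "card B < card C + m"
  using m
proof
  assume "m = 2"
  then have "\<exists>u v. u \<in> U \<and> v \<in> U \<and> u \<noteq> v"
    using U by (auto simp: card_le_Suc_iff numeral_2_eq_2)
  then show ?thesis
    using blocks_card_2[OF K(1) _ inj blk] K \<open>m = 2\<close> by fastforce
next
  assume "m = 3"
  then show ?thesis
    using blocks_card_3[OF K(1) _ inj blk] K U by fastforce
qed

lemma interval_commute: "interval x y = interval y x"
  by (auto simp: interval_def)

text \<open>\<open>C\<close> blocks \<open>A - C\<close> from \<open>B\<close>, and \<open>D\<close>
  blocks \<open>B - D\<close> from \<open>A\<close>. The differences are taken because
  \<open>A\<close> may meet \<open>C\<close> and \<open>B\<close> may meet \<open>D\<close>.\<close>

lemma mutual_blocking:
  assumes K: "finite K" "card K \<le> m + 1" and m: "m = 2 \<or> m = 3"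
    and inj: "inj_on (\<lambda>x. x \<inter> K) (A \<union> B \<union> C \<union> D)"
    and disj: "A \<inter> D = {}" "B \<inter> C = {}"
    and meet: "\<And>u w. u \<in> A \<Longrightarrow> w \<in> B \<Longrightarrow> interval u w \<inter> C \<noteq> {} \<and> interval u w \<inter> D \<noteq> {}"
    and A: "card D + m \<le> card A"
  shows "card B < card C + m"
proof (rule ccontr)
  assume B: "\<not> card B < card C + m"
  have fin: "finite A" "finite B" "finite C" "finite D"
    using finite_if_inj_on_trace[OF K(1) inj] by auto
  have split: "card A = card (A - C) + card (A \<inter> C)" "card B = card (B - D) + card (B \<inter> D)"
    using fin card_Diff_subset_Int[of A C] card_Diff_subset_Int[of B D]
    by (auto simp: card_mono)
  have le: "card (A \<inter> C) \<le> card C" "card (B \<inter> D) \<le> card D"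
    using fin by (auto intro: card_mono)
  \<comment> \<open>If both excesses are at least \<open>m\<close>, the two differences together
    have at least \<open>2 * m\<close> elements: the removed parts cost no more than
    \<open>card C\<close> and \<open>card D\<close>.\<close>
  have "m \<le> card (A - C) \<or> m \<le> card (B - D)"
    using split le A B by linarith
  then show False
  proof
    assume U: "m \<le> card (A - C)"
    have "blocks C (A - C) B" using meet disj by (auto simp: blocks_def)
    from blocks_card[OF K m inj_on_subset[OF inj] this U] B show False by blast
  next
    assume U: "m \<le> card (B - D)"
    have "interval u w \<inter> D \<noteq> {}" if "u \<in> B" "w \<in> A" for u w
      using meet[OF that(2,1)] interval_commute[of u w] by simp
    then have "blocks D (B - D) A" using disj by (auto simp: blocks_def)
    from blocks_card[OF K m inj_on_subset[OF inj] this U] A show False by fastforce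
  qed
qed

section \<open>Lower bounds for cuts, by splitting along a coordinate\<close>

text \<open>The parameter $m$ is two less than the admitted number of separating coordinates: $m = 2$
  yields the extra edge that the induction needs, $m = 3$ just the minimum.\<close>

definition cut_bound :: "nat \<Rightarrow> nat \<Rightarrow> nat \<Rightarrow> nat"
  where "cut_bound m s t =
    (if s = 0 \<or> t = 0 then 0 else min s t + (if s = t then 0 else 3 - m))"

lemma cut_bound_le: "s \<le> t \<Longrightarrow> cut_bound m s t \<le> s + (if s = t then 0 else 3 - m)"
  by (simp add: cut_bound_def)

lemma cut_bound_commute: "cut_bound m s t = cut_bound m t s"
  by (simp add: cut_bound_def min.commute)

lemma cut_bound_2_less:
  assumes "0 < s" "s < t"
  shows "cut_bound 2 s t = Suc s" and "cut_bound 2 t s = Suc s"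
  using assms by (simp_all add: cut_bound_def)

lemma cut_bound_2_ge: "s \<le> t \<Longrightarrow> s \<le> cut_bound 2 s t"
  by (auto simp: cut_bound_def)

text \<open>Vertices are abstract and \<open>\<sigma>\<close> gives their 0/1-coordinates as a set.
  Vertex sets are passed as arguments below, so that going to a face of the cube keeps the graph
  fixed.\<close>

locale cube_graph =
  fixes \<sigma> :: "'a \<Rightarrow> 'j set" and adj :: "'a \<Rightarrow> 'a \<Rightarrow> bool"
  assumes adj_sym: "adj u v \<Longrightarrow> adj v u"
begin

text \<open>Ordered pairs are counted; for disjoint \<open>S\<close> and \<open>T\<close> each edge
  between them contributes exactly one.\<close>

definition cut :: "'a set \<Rightarrow> 'a set \<Rightarrow> nat"
  where "cut S T = card {(u, v) \<in> S \<times> T. adj u v}"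

text \<open>Prescribing the coordinate \<open>j\<close> yields edges across any chosen splitting.
  The interval condition keeps the neighbour on every side that contains both \<open>u\<close> and
  \<open>w\<close>, so the property passes to sides.\<close>

definition interval_connected :: "'a set \<Rightarrow> bool"
  where "interval_connected X \<longleftrightarrow>
    (\<forall>u\<in>X. \<forall>w\<in>X. \<forall>j. (j \<in> \<sigma> u) \<noteq> (j \<in> \<sigma> w) \<longrightarrow>
      (\<exists>v\<in>X. adj u v \<and> \<sigma> v \<in> interval (\<sigma> u) (\<sigma> w) \<and> (j \<in> \<sigma> v) = (j \<in> \<sigma> w)))"

definition side :: "'j \<Rightarrow> bool \<Rightarrow> 'a set \<Rightarrow> 'a set"
  where "side i b X = {x \<in> X. (i \<in> \<sigma> x) = b}"

lemma cut_commute: "cut S T = cut T S"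
proof -
  have "{(u, v) \<in> T \<times> S. adj u v} = prod.swap ` {(u, v) \<in> S \<times> T. adj u v}"
    using adj_sym by force
  then show ?thesis
    unfolding cut_def by (simp add: card_image)
qed

lemma cut_Un_left:
  assumes "finite S" "finite S'" "finite T" "S \<inter> S' = {}"
  shows "cut (S \<union> S') T = cut S T + cut S' T"
proof -
  have "{(u, v) \<in> (S \<union> S') \<times> T. adj u v} =
      {(u, v) \<in> S \<times> T. adj u v} \<union> {(u, v) \<in> S' \<times> T. adj u v}"
    by auto
  moreover have "finite {(u, v) \<in> S \<times> T. adj u v}" "finite {(u, v) \<in> S' \<times> T. adj u v}"
    using assms by (auto intro: finite_subset[of _ "S \<times> T"] finite_subset[of _ "S' \<times> T"])
  moreover have "{(u, v) \<in> S \<times> T. adj u v} \<inter> {(u, v) \<in> S' \<times> T. adj u v} = {}"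
    using assms(4) by auto
  ultimately show ?thesis
    unfolding cut_def by (metis (no_types, lifting) card_Un_disjoint)
qed

lemma cut_Un_right:
  assumes "finite S" "finite T" "finite T'" "T \<inter> T' = {}"
  shows "cut S (T \<union> T') = cut S T + cut S T'"
  using cut_Un_left[of T T' S] assms by (simp add: cut_commute)

lemma side_Un: "side i True X \<union> side i False X = X"
  and side_disjoint: "side i True X \<inter> side i False X = {}"
  and finite_side: "finite X \<Longrightarrow> finite (side i b X)"
  by (auto simp: side_def)

lemma card_sides:
  assumes "finite X"
  shows "card X = card (side i True X) + card (side i False X)"
  using card_Un_disjoint[of "side i True X" "side i False X"] assms
  by (simp add: side_Un side_disjoint finite_side)

lemma cut_sides:
  assumes "finite S" "finite T"
  shows "cut S T = cut (side i True S) (side i True T) + cut (side i True S) (side i False T) +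
    cut (side i False S) (side i True T) + cut (side i False S) (side i False T)"
proof -
  have "cut S T = cut (side i True S \<union> side i False S) (side i True T \<union> side i False T)"
    by (simp add: side_Un)
  then show ?thesis
    using assms by (simp add: cut_Un_left cut_Un_right finite_side side_disjoint)
qed

lemma interval_connected_side:
  assumes "interval_connected X"
  shows "interval_connected (side i b X)"
  unfolding interval_connected_def
proof (intro ballI allI impI)
  fix u w j assume *: "u \<in> side i b X" "w \<in> side i b X" "(j \<in> \<sigma> u) \<noteq> (j \<in> \<sigma> w)"
  then obtain v where v: "v \<in> X" "adj u v" "\<sigma> v \<in> interval (\<sigma> u) (\<sigma> w)"
      "(j \<in> \<sigma> v) = (j \<in> \<sigma> w)"
    using assms by (fastforce simp: interval_connected_def side_def)
  moreover have "v \<in> side i b X"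
    using * v(1,3) by (auto simp: side_def interval_def)
  ultimately show "\<exists>v\<in>side i b X. adj u v \<and> \<sigma> v \<in> interval (\<sigma> u) (\<sigma> w) \<and>
      (j \<in> \<sigma> v) = (j \<in> \<sigma> w)"
    by blast
qed

text \<open>A vertex of \<open>S\<close> that has a neighbour in \<open>T\<close> is the first
  component of some counted pair.\<close>

lemma card_le_cut_add_isolated:
  assumes "finite S" "finite T"
  shows "card S \<le> cut S T + card {u \<in> S. \<forall>v\<in>T. \<not> adj u v}"
proof -
  let ?E = "{(u, v) \<in> S \<times> T. adj u v}"
  have fin: "finite ?E"
    using assms by (auto intro: finite_subset[of _ "S \<times> T"])
  have "S \<subseteq> fst ` ?E \<union> {u \<in> S. \<forall>v\<in>T. \<not> adj u v}" by force
  then have "card S \<le> card (fst ` ?E \<union> {u \<in> S. \<forall>v\<in>T. \<not> adj u v})"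
    using fin assms by (intro card_mono) auto
  also have "\<dots> \<le> card (fst ` ?E) + card {u \<in> S. \<forall>v\<in>T. \<not> adj u v}"
    by (rule card_Un_le)
  also have "card (fst ` ?E) \<le> card ?E"
    by (rule card_image_le[OF fin])
  finally show ?thesis by (simp add: cut_def)
qed

lemma card_le_cut:
  assumes "finite S" "finite T" "\<And>u. u \<in> S \<Longrightarrow> \<exists>v\<in>T. adj u v"
  shows "card S \<le> cut S T"
proof -
  have none: "{u \<in> S. \<forall>v\<in>T. \<not> adj u v} = {}" using assms(3) by blast
  show ?thesis
    using card_le_cut_add_isolated[OF assms(1,2)] unfolding none by simp
qed

text \<open>If both inequalities fail, the sets \<open>A\<close> and \<open>B\<close> of vertices
  without cut edges across exceed \<open>card T0\<close> and \<open>card S1\<close> by at least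
  \<open>m\<close>. Since \<open>S1\<close> and \<open>T0\<close> meet all intervals between them,
  this contradicts \<open>mutual_blocking\<close>.\<close>

lemma cross_edges:
  assumes fin: "finite S0" "finite T0" "finite S1" "finite T1"
    and K: "finite K" "card K \<le> m + 1" and m: "m = 2 \<or> m = 3"
    and disj: "S0 \<inter> T0 = {}" "S1 \<inter> T1 = {}"
    and inj: "inj_on (\<lambda>x. \<sigma> x \<inter> K) (S0 \<union> T0)" "inj_on (\<lambda>x. \<sigma> x \<inter> K) (S1 \<union> T1)"
    and nb0: "\<And>u w. u \<in> S0 \<Longrightarrow> w \<in> S1 \<union> T1 \<Longrightarrow>
      \<exists>v\<in>S1 \<union> T1. adj u v \<and> \<sigma> v \<in> interval (\<sigma> u) (\<sigma> w)"
    and nb1: "\<And>u w. u \<in> S0 \<union> T0 \<Longrightarrow> w \<in> T1 \<Longrightarrow>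
      \<exists>v\<in>S0 \<union> T0. adj v w \<and> \<sigma> v \<in> interval (\<sigma> u) (\<sigma> w)"
  shows "card S0 < cut S0 T1 + card T0 + m \<or> card T1 < cut S0 T1 + card S1 + m"
proof (rule ccontr)
  assume neg: "\<not> ?thesis"
  \<comment> \<open>Restriction to \<open>K\<close> puts both sides into one cube. The images of
    \<open>A\<close> and \<open>S1\<close>, or of \<open>B\<close> and \<open>T0\<close>, may
    overlap there.\<close>
  define \<tau> where "\<tau> = (\<lambda>x. \<sigma> x \<inter> K)"
  define A where "A = {u \<in> S0. \<forall>v\<in>T1. \<not> adj u v}"
  define B where "B = {w \<in> T1. \<forall>v\<in>S0. \<not> adj w v}"
  have AB: "A \<subseteq> S0" "B \<subseteq> T1" by (auto simp: A_def B_def)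
  have "card S0 \<le> cut S0 T1 + card A"
    using card_le_cut_add_isolated[OF fin(1,4)] by (simp add: A_def)
  moreover have "card T1 \<le> cut S0 T1 + card B"
    using card_le_cut_add_isolated[OF fin(4,1)] cut_commute[of S0 T1] by (simp add: B_def)
  ultimately have large: "card T0 + m \<le> card A" "card S1 + m \<le> card B"
    using neg by linarith+
  have inj\<tau>: "inj_on \<tau> (S0 \<union> T0)" "inj_on \<tau> (S1 \<union> T1)"
    using inj by (simp_all add: \<tau>_def)
  have cards: "card (\<tau> ` A) = card A" "card (\<tau> ` B) = card B"
      "card (\<tau> ` S1) = card S1" "card (\<tau> ` T0) = card T0"
    using AB by (auto intro!: card_image intro: inj_on_subset[OF inj\<tau>(1)] inj_on_subset[OF inj\<tau>(2)])
  have meet: "interval u w \<inter> \<tau> ` S1 \<noteq> {} \<and> interval u w \<inter> \<tau> ` T0 \<noteq> {}"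
    if "u \<in> \<tau> ` A" "w \<in> \<tau> ` B" for u w
  proof -
    from that obtain u' w' where u': "u' \<in> A" "u = \<tau> u'" and w': "w' \<in> B" "w = \<tau> w'"
      by blast
    have trace: "\<tau> v \<in> interval u w" if "\<sigma> v \<in> interval (\<sigma> u') (\<sigma> w')" for v
      using that u' w' by (auto simp: interval_def \<tau>_def)
    obtain v where "v \<in> S1 \<union> T1" "adj u' v" "\<sigma> v \<in> interval (\<sigma> u') (\<sigma> w')"
      using nb0[of u' w'] u' w' AB by blast
    then have 1: "v \<in> S1" "\<tau> v \<in> interval u w"
      using u' trace by (auto simp: A_def)
    obtain v' where "v' \<in> S0 \<union> T0" "adj v' w'" "\<sigma> v' \<in> interval (\<sigma> u') (\<sigma> w')"
      using nb1[of u' w'] u' w' AB by blast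
    then have "v' \<in> T0" "\<tau> v' \<in> interval u w"
      using w' trace adj_sym by (auto simp: B_def)
    with 1 show ?thesis by blast
  qed
  have "\<tau> ` A \<inter> \<tau> ` T0 = \<tau> ` (A \<inter> T0)"
    using AB by (intro inj_on_image_Int[symmetric, OF inj\<tau>(1)]) auto
  moreover have "\<tau> ` B \<inter> \<tau> ` S1 = \<tau> ` (B \<inter> S1)"
    using AB by (intro inj_on_image_Int[symmetric, OF inj\<tau>(2)]) auto
  moreover have "A \<inter> T0 = {}" "B \<inter> S1 = {}" using AB disj by auto
  ultimately have "\<tau> ` A \<inter> \<tau> ` T0 = {}" "\<tau> ` B \<inter> \<tau> ` S1 = {}" by auto
  moreover have "inj_on (\<lambda>x. x \<inter> K) (\<tau> ` A \<union> \<tau> ` B \<union> \<tau> ` S1 \<union> \<tau> ` T0)"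
    by (auto simp: inj_on_def \<tau>_def)
  ultimately have "card (\<tau> ` B) < card (\<tau> ` S1) + m"
    using large by (intro mutual_blocking[OF K m _ _ _ meet, of "\<tau> ` A" "\<tau> ` B"])
      (simp_all only: cards)
  with large show False by (simp add: cards)
qed

text \<open>If \<open>T0\<close> and \<open>S1\<close> are nonempty, the sides contribute at least
  \<open>card T0 + 1\<close> and \<open>card S1 + 1\<close> edges, and \<open>cross_edges\<close>
  adds \<open>card S0 - card T0 - m + 1\<close> or \<open>card T1 - card S1 - m + 1\<close>. The sum
  exceeds \<open>card S0 + card S1\<close> or \<open>card T0 + card T1\<close> by
  \<open>3 - m\<close>. If \<open>T0\<close> or \<open>S1\<close> is empty, its extra edge is
  missing, but then the cross edges alone number at least \<open>card T1\<close> or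
  \<open>card S0\<close>, respectively.\<close>

lemma unbalanced_sides:
  assumes fin: "finite S0" "finite T0" "finite S1" "finite T1"
    and K: "finite K" "card K \<le> m + 1" and m: "m = 2 \<or> m = 3"
    and disj: "S0 \<inter> T0 = {}" "S1 \<inter> T1 = {}"
    and inj: "inj_on (\<lambda>x. \<sigma> x \<inter> K) (S0 \<union> T0)" "inj_on (\<lambda>x. \<sigma> x \<inter> K) (S1 \<union> T1)"
    and nb0: "\<And>u w. u \<in> S0 \<Longrightarrow> w \<in> S1 \<union> T1 \<Longrightarrow>
      \<exists>v\<in>S1 \<union> T1. adj u v \<and> \<sigma> v \<in> interval (\<sigma> u) (\<sigma> w)"
    and nb1: "\<And>u w. u \<in> S0 \<union> T0 \<Longrightarrow> w \<in> T1 \<Longrightarrow>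
      \<exists>v\<in>S0 \<union> T0. adj v w \<and> \<sigma> v \<in> interval (\<sigma> u) (\<sigma> w)"
    and IH: "cut_bound 2 (card S0) (card T0) \<le> cut S0 T0"
      "cut_bound 2 (card S1) (card T1) \<le> cut S1 T1"
    and gt: "card T0 < card S0"
    and le: "card S0 + card S1 \<le> card T0 + card T1"
  shows "cut_bound m (card S0 + card S1) (card T0 + card T1) \<le>
    cut S0 T0 + cut S1 T1 + cut S0 T1"
proof -
  have lt: "card S1 < card T1" using gt le by linarith
  then obtain u w where uw: "u \<in> S0" "w \<in> T1" using gt by fastforce
  have S1: "card S0 \<le> cut S0 T1" if "card S1 = 0"
  proof (rule card_le_cut[OF fin(1,4)])
    show "\<exists>v\<in>T1. adj x v" if "x \<in> S0" for x
      using nb0[OF that, of w] uw \<open>card S1 = 0\<close> fin by auto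
  qed
  have T0: "card T1 \<le> cut S0 T1" if "card T0 = 0"
  proof (subst cut_commute, rule card_le_cut[OF fin(4,1)])
    show "\<exists>v\<in>S0. adj x v" if "x \<in> T1" for x
      using nb1[OF _ that, of u] uw \<open>card T0 = 0\<close> fin adj_sym by auto
  qed
  have "card S0 < cut S0 T1 + card T0 + m \<or> card T1 < cut S0 T1 + card S1 + m"
    by (rule cross_edges[OF fin K m disj inj nb0 nb1])
  moreover have "card T0 < cut S0 T0" if "0 < card T0"
    using cut_bound_2_less(2)[OF that gt] IH by simp
  moreover have "card S1 < cut S1 T1" if "0 < card S1"
    using cut_bound_2_less(1)[OF that lt] IH by simp
  \<comment> \<open>Subtraction on \<open>nat\<close> truncates; this equation tells linear
    arithmetic the true value of \<open>3 - m\<close>.\<close>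
  moreover have "3 - m + m = 3" using m by auto
  ultimately have "card S0 + card S1 + (if card S0 + card S1 = card T0 + card T1 then 0 else 3 - m)
      \<le> cut S0 T0 + cut S1 T1 + cut S0 T1"
    using S1 T0 gt lt le m by (cases "card T0 = 0"; cases "card S1 = 0") (simp; linarith)+
  then show ?thesis
    using cut_bound_le[OF le, of m] by linarith
qed

text \<open>If \<open>S\<close> outnumbers \<open>T\<close> on some side, then \<open>T\<close>
  outnumbers \<open>S\<close> on the other one because \<open>card S \<le> card T\<close>, and
  \<open>unbalanced_sides\<close> applies. Otherwise \<open>S\<close> is no larger than
  \<open>T\<close> on both sides and the bounds of the two sides add up.\<close>

lemma cut_bound_step:
  assumes fin: "finite S" "finite T" and disj: "S \<inter> T = {}"
    and conn: "interval_connected (S \<union> T)"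
    and K: "finite K" "card K \<le> m + 1" and m: "m = 2 \<or> m = 3"
    and inj: "\<And>b. inj_on (\<lambda>x. \<sigma> x \<inter> K) (side i b (S \<union> T))"
    and ne: "\<And>b. side i b (S \<union> T) \<noteq> {}"
    and IH: "\<And>b. cut_bound 2 (card (side i b S)) (card (side i b T)) \<le>
      cut (side i b S) (side i b T)"
    and le: "card S \<le> card T"
  shows "cut_bound m (card S) (card T) \<le> cut S T"
proof -
  have side_un: "side i b (S \<union> T) = side i b S \<union> side i b T" for b
    by (auto simp: side_def)
  have sdisj: "side i b S \<inter> side i b T = {}" for b
    using disj by (auto simp: side_def)
  have nb: "\<exists>v\<in>side i (\<not> b) S \<union> side i (\<not> b) T. adj u v \<and> \<sigma> v \<in> interval (\<sigma> u) (\<sigma> w)"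
    if "u \<in> side i b S \<union> side i b T" "w \<in> side i (\<not> b) S \<union> side i (\<not> b) T" for b u w
  proof -
    have "(i \<in> \<sigma> u) \<noteq> (i \<in> \<sigma> w)" "u \<in> S \<union> T" "w \<in> S \<union> T"
      using that by (auto simp: side_def)
    then obtain v where "v \<in> S \<union> T" "adj u v" "\<sigma> v \<in> interval (\<sigma> u) (\<sigma> w)"
        "(i \<in> \<sigma> v) = (i \<in> \<sigma> w)"
      using conn unfolding interval_connected_def by blast
    moreover have "v \<in> side i (\<not> b) S \<union> side i (\<not> b) T"
      using calculation that by (auto simp: side_def)
    ultimately show ?thesis by blast
  qed
  have cards: "card S = card (side i b S) + card (side i (\<not> b) S)"
      "card T = card (side i b T) + card (side i (\<not> b) T)" for b
    using card_sides[of S i] card_sides[of T i] fin by (cases b; simp)+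
  have cuts: "cut S T = cut (side i b S) (side i b T) + cut (side i (\<not> b) S) (side i (\<not> b) T) +
      cut (side i b S) (side i (\<not> b) T) + cut (side i (\<not> b) S) (side i b T)" for b
    using cut_sides[OF fin, of i] by (cases b) auto
  show ?thesis
  proof (cases "\<exists>b. card (side i b T) < card (side i b S)")
    case True
    then obtain b where b: "card (side i b T) < card (side i b S)" by blast
    have "cut_bound m (card (side i b S) + card (side i (\<not> b) S))
        (card (side i b T) + card (side i (\<not> b) T)) \<le>
      cut (side i b S) (side i b T) + cut (side i (\<not> b) S) (side i (\<not> b) T) +
      cut (side i b S) (side i (\<not> b) T)"
    proof (rule unbalanced_sides[OF _ _ _ _ K m sdisj sdisj _ _ _ _ IH IH b])
      show "\<exists>v\<in>side i (\<not> b) S \<union> side i (\<not> b) T. adj u v \<and> \<sigma> v \<in> interval (\<sigma> u) (\<sigma> w)"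
        if "u \<in> side i b S" "w \<in> side i (\<not> b) S \<union> side i (\<not> b) T" for u w
        using nb that by blast
      show "\<exists>v\<in>side i b S \<union> side i b T. adj v w \<and> \<sigma> v \<in> interval (\<sigma> u) (\<sigma> w)"
        if "u \<in> side i b S \<union> side i b T" "w \<in> side i (\<not> b) T" for u w
        using nb[of w "\<not> b" u] that adj_sym by (auto simp: interval_commute)
    qed (use fin inj le cards[of b] in \<open>auto simp: finite_side side_un[symmetric]\<close>)
    then show ?thesis
      using cards[of b] cuts[of b] by simp
  next
    case False
    then have sides: "card (side i b S) \<le> card (side i b T)" for b
      by (meson not_le)
    \<comment> \<open>On a side without vertices of \<open>S\<close>, \<open>cut_bound\<close> is
      zero. The missing edge is found across: every vertex of \<open>S\<close> has a neighbour on
      that side, necessarily in \<open>T\<close>.\<close>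
    have extra: "1 \<le> cut (side i (\<not> b) S) (side i b T)"
      if b: "card (side i b S) = 0" "0 < card (side i (\<not> b) S)" for b
    proof -
      obtain u where u: "u \<in> side i (\<not> b) S" using b by fastforce
      have "side i b S = {}" using b fin by (simp add: finite_side)
      then have "\<exists>v\<in>side i b T. adj u v" if "u \<in> side i (\<not> b) S" for u
        using nb[of u "\<not> b"] ne[of b] that by (auto simp: side_un)
      then have "card (side i (\<not> b) S) \<le> cut (side i (\<not> b) S) (side i b T)"
        using fin by (intro card_le_cut) (auto simp: finite_side)
      with b show ?thesis by linarith
    qed
    have ge: "card (side i b S) \<le> cut (side i b S) (side i b T)" for b
      using cut_bound_2_ge[OF sides] IH le_trans by blast
    \<comment> \<open>Some side has strictly fewer vertices of \<open>S\<close> than of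
      \<open>T\<close>. It supplies the additional edge through \<open>IH\<close>, or through
      \<open>extra\<close> if it contains no vertex of \<open>S\<close>.\<close>
    have strict: "card S < cut S T" if less: "card S < card T" and pos: "0 < card S"
    proof -
      obtain b where b: "card (side i b S) < card (side i b T)"
        using less sides cards[of True] by (metis add_mono not_le)
      show ?thesis
      proof (cases "card (side i b S) = 0")
        case True
        then show ?thesis
          using extra[of b] ge[of b] ge[of "\<not> b"] cards(1)[of b] cuts[of b] pos by linarith
      next
        case False
        then have "card (side i b S) < cut (side i b S) (side i b T)"
          using cut_bound_2_less(1)[OF _ b] IH[of b] by simp
        then show ?thesis
          using ge[of "\<not> b"] cards(1)[of b] cuts[of b] by linarith
      qed
    qed
    have "card S \<le> cut S T"
      using ge[of True] ge[of False] cards(1)[of True] cuts[of True] by simp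
    \<comment> \<open>One additional edge is enough, since \<open>3 - m\<close> is at most
      one.\<close>
    then show ?thesis
      using strict le m by (auto simp: cut_bound_def)
  qed
qed

text \<open>The bound for fewer coordinates is an assumption, so that the same reduction serves the
  induction with \<open>m = 2\<close> and the final split with \<open>m = 3\<close>.\<close>

lemma cut_bound_split:
  assumes fin: "finite S" "finite T" and disj: "S \<inter> T = {}"
    and conn: "interval_connected (S \<union> T)"
    and J: "finite J" "card J \<le> m + 2" and m: "m = 2 \<or> m = 3"
    and inj: "inj_on (\<lambda>x. \<sigma> x \<inter> J) (S \<union> T)"
    and IH: "\<And>i A B. i \<in> J \<Longrightarrow> finite A \<Longrightarrow> finite B \<Longrightarrow> A \<inter> B = {} \<Longrightarrow>
      interval_connected (A \<union> B) \<Longrightarrow> inj_on (\<lambda>x. \<sigma> x \<inter> (J - {i})) (A \<union> B) \<Longrightarrow>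
      cut_bound 2 (card A) (card B) \<le> cut A B"
  shows "cut_bound m (card S) (card T) \<le> cut S T"
proof (cases "S = {} \<or> T = {}")
  case True
  then show ?thesis by (auto simp: cut_bound_def)
next
  case False
  then obtain u w where uw: "u \<in> S" "w \<in> T" by blast
  then have "\<sigma> u \<inter> J \<noteq> \<sigma> w \<inter> J" using inj disj by (auto simp: inj_on_def)
  \<comment> \<open>The chosen coordinate separates a vertex of \<open>S\<close> from one of
    \<open>T\<close>, which makes both sides of \<open>S \<union> T\<close> nonempty.\<close>
  then obtain i where i: "i \<in> J" "(i \<in> \<sigma> u) \<noteq> (i \<in> \<sigma> w)" by blast
  have K: "finite (J - {i})" "card (J - {i}) \<le> m + 1" using J i by auto
  have inj': "inj_on (\<lambda>x. \<sigma> x \<inter> (J - {i})) (side i b (S \<union> T))" for b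
  proof (rule inj_onI)
    fix x y assume *: "x \<in> side i b (S \<union> T)" "y \<in> side i b (S \<union> T)"
      "\<sigma> x \<inter> (J - {i}) = \<sigma> y \<inter> (J - {i})"
    then have "\<sigma> x \<inter> J = \<sigma> y \<inter> J" by (auto simp: side_def)
    with * inj show "x = y" by (auto simp: side_def inj_on_def)
  qed
  have un: "side i b (S \<union> T) = side i b S \<union> side i b T" for b
    by (auto simp: side_def)
  have ne: "side i b (S \<union> T) \<noteq> {}" for b
    using uw i by (auto simp: side_def)
  have IH': "cut_bound 2 (card (side i b S)) (card (side i b T)) \<le> cut (side i b S) (side i b T)" for b
  proof (rule IH[OF i(1)])
    show "interval_connected (side i b S \<union> side i b T)"
      using interval_connected_side[OF conn, of i b] by (simp add: un)
    show "inj_on (\<lambda>x. \<sigma> x \<inter> (J - {i})) (side i b S \<union> side i b T)"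
      using inj' by (simp add: un)
  qed (use fin disj in \<open>auto simp: side_def\<close>)
  show ?thesis
  proof (cases "card S \<le> card T")
    case True
    show ?thesis by (rule cut_bound_step[OF fin disj conn K m inj' ne IH' True])
  next
    case False
    have "cut_bound m (card T) (card S) \<le> cut T S"
    proof (rule cut_bound_step[OF fin(2,1) _ _ K m])
      show "cut_bound 2 (card (side i b T)) (card (side i b S)) \<le> cut (side i b T) (side i b S)" for b
        using IH'[of b] by (simp add: cut_bound_commute cut_commute)
    qed (use disj conn inj' ne False in \<open>auto simp: Un_commute\<close>)
    then show ?thesis by (simp add: cut_bound_commute cut_commute)
  qed
qed

text \<open>For \<open>m = 2\<close> the reduction returns the very bound that it assumes for the
  sides, so it can be iterated while coordinates are removed from \<open>J\<close>.\<close>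

lemma cut_bound_4:
  assumes "finite S" "finite T" "S \<inter> T = {}" "interval_connected (S \<union> T)"
    and "finite J" "card J \<le> 4" "inj_on (\<lambda>x. \<sigma> x \<inter> J) (S \<union> T)"
  shows "cut_bound 2 (card S) (card T) \<le> cut S T"
  using assms
proof (induction "card J" arbitrary: J S T rule: less_induct)
  case less
  show ?case
  proof (rule cut_bound_split[OF less.prems(1-5)])
    fix i A B
    assume i: "i \<in> J" and *: "finite A" "finite B" "A \<inter> B = {}" "interval_connected (A \<union> B)"
      "inj_on (\<lambda>x. \<sigma> x \<inter> (J - {i})) (A \<union> B)"
    have "card (J - {i}) < card J" by (rule card_Diff1_less[OF less.prems(5) i])
    from less.hyps[OF this *(1-4) _ _ *(5)] less.prems this
    show "cut_bound 2 (card A) (card B) \<le> cut A B" by simp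
  qed (use less.prems in auto)
qed

text \<open>One more split, now with \<open>m = 3\<close>: the sides still have the extra edge from
  \<open>cut_bound_4\<close>, and the fifth coordinate uses it up.\<close>

lemma min_card_le_cut:
  assumes fin: "finite S" "finite T" and disj: "S \<inter> T = {}"
    and conn: "interval_connected (S \<union> T)"
    and J: "finite J" "card J \<le> 5" and inj: "inj_on (\<lambda>x. \<sigma> x \<inter> J) (S \<union> T)"
  shows "min (card S) (card T) \<le> cut S T"
proof -
  have "cut_bound 3 (card S) (card T) \<le> cut S T"
  proof (rule cut_bound_split[OF fin disj conn J(1) _ _ inj])
    fix i A B
    assume "i \<in> J" and *: "finite A" "finite B" "A \<inter> B = {}" "interval_connected (A \<union> B)"
      "inj_on (\<lambda>x. \<sigma> x \<inter> (J - {i})) (A \<union> B)"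
    then show "cut_bound 2 (card A) (card B) \<le> cut A B"
      using J by (intro cut_bound_4[OF *(1-4) _ _ *(5)]) auto
  qed (use J in auto)
  then show ?thesis by (auto simp: cut_bound_def split: if_splits)
qed

end

section \<open>Edges of polytopes at a vertex\<close>

text \<open>Induction on the dimension: a facet \<open>h\<close> through \<open>u\<close> that is
  not inside \<open>G\<close> has the proper face \<open>G \<inter> h\<close>, and an edge of
  \<open>h\<close> leaving it also leaves \<open>G\<close>. Without such a facet, \<open>P\<close>
  turns out to be a segment and is itself the edge.\<close>

lemma edge_leaving_face:
  fixes P :: "'a::euclidean_space set"
  assumes "polytope P" "G face_of P" "G \<noteq> P" "u extreme_point_of P" "u \<in> G"
  obtains e where "e edge_of P" "u \<in> e" "\<not> e \<subseteq> G"
proof -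
  have "\<exists>e. e edge_of P \<and> u \<in> e \<and> \<not> e \<subseteq> G"
    using assms
  proof (induction "nat (aff_dim P)" arbitrary: P G rule: less_induct)
    case less
    have poly: "polyhedron P" and conv: "convex P"
      using less.prems(1) polytope_imp_polyhedron polytope_imp_convex by auto
    have u: "{u} face_of P" using less.prems(4) by (simp add: face_of_singleton)
    have "{u} \<noteq> P" using less.prems(2,3,5) face_of_imp_subset by blast
    show ?case
    proof (cases "\<exists>h. h facet_of P \<and> u \<in> h \<and> \<not> h \<subseteq> G")
      case True
      then obtain h where h: "h facet_of P" "u \<in> h" "\<not> h \<subseteq> G" by blast
      have hP: "h face_of P" using h facet_of_imp_face_of by blast
      have "aff_dim h < aff_dim P" using h by (simp add: facet_of_def)
      moreover have "0 \<le> aff_dim h"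
        using h(2) aff_dim_geq[of h] aff_dim_empty[of h] by fastforce
      ultimately have "nat (aff_dim h) < nat (aff_dim P)" by linarith
      moreover have "polytope h" using hP less.prems(1) face_of_polytope_polytope by blast
      moreover have "G \<inter> h face_of h"
        using less.prems(2) hP by (meson face_of_Int face_of_imp_subset face_of_subset inf_le2)
      moreover have "u extreme_point_of h"
        using hP h less.prems(4) by (simp add: extreme_point_of_face)
      moreover have "G \<inter> h \<noteq> h" "u \<in> G \<inter> h" using h less.prems(5) by auto
      ultimately obtain e where "e edge_of h" "u \<in> e" "\<not> e \<subseteq> G \<inter> h"
        using less.hyps by blast
      then show ?thesis
        using hP by (meson edge_of_def edge_of_imp_subset face_of_trans le_inf_iff)
    next
      case False
      \<comment> \<open>Facets have codimension one and \<open>G\<close> is a proper face, so a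
        facet contained in \<open>G\<close> must fill it.\<close>
      have facet: "h = G" if h: "h facet_of P" "u \<in> h" for h
      proof (rule ccontr)
        assume "h \<noteq> G"
        have "h \<subseteq> G" using False h by blast
        then have "h face_of G"
          using h less.prems(2) facet_of_imp_face_of face_of_imp_subset face_of_subset by metis
        then have "aff_dim h < aff_dim G"
          using \<open>h \<noteq> G\<close> less.prems(2) face_of_aff_dim_lt face_of_imp_convex by metis
        moreover have "aff_dim G < aff_dim P"
          using less.prems(2,3) conv face_of_aff_dim_lt by blast
        ultimately show False using h by (auto simp: facet_of_def)
      qed
      \<comment> \<open>A proper face of a polyhedron is the intersection of the facets containing
        it. As \<open>G\<close> is the only facet through \<open>u\<close>, it is the point
        \<open>u\<close>, and \<open>P\<close> has dimension one.\<close>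
      have eq: "{u} = \<Inter>{h. h facet_of P \<and> {u} \<subseteq> h}"
        by (rule face_of_polyhedron[OF poly u]) (use \<open>{u} \<noteq> P\<close> in auto)
      obtain h where h: "h facet_of P" "u \<in> h"
        using face_of_polyhedron_subset_facet[OF poly u] \<open>{u} \<noteq> P\<close> by blast
      have "{h. h facet_of P \<and> {u} \<subseteq> h} = {G}" using facet h by blast
      then have "{u} = G" using eq by simp
      moreover have "aff_dim G = aff_dim P - 1" using facet[OF h] h by (auto simp: facet_of_def)
      ultimately have "aff_dim P = 1" by auto
      then have "P edge_of P" using conv by (simp add: edge_of_def face_of_refl)
      then show ?thesis
        using less.prems by (meson face_of_imp_subset subset_antisym subsetD)
    qed
  qed
  then show ?thesis using that by blast
qed

text \<open>A one-dimensional face of a polytope is compact, convex and collinear, hence a segment,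
  whose extreme points are its two ends.\<close>

lemma edge_eq_segment:
  fixes P :: "'a::euclidean_space set"
  assumes "polytope P" "e edge_of P" "u extreme_point_of P" "u \<in> e"
  obtains v where "v extreme_point_of P" "v \<noteq> u" "e = closed_segment u v"
proof -
  have face: "e face_of P" and dim: "aff_dim e = 1" using assms(2) by (auto simp: edge_of_def)
  then have "polytope e" using assms(1) face_of_polytope_polytope by blast
  moreover have "collinear e" using dim by (simp add: collinear_aff_dim)
  ultimately obtain a b where ab: "e = closed_segment a b"
    using compact_convex_collinear_segment polytope_imp_compact polytope_imp_convex assms(4)
    by (metis empty_iff)
  have "a \<noteq> b" using dim ab by auto
  have ext: "x extreme_point_of P" if "x = a \<or> x = b" for x
    using that face extreme_point_of_face[OF face, of x] by (auto simp: ab extreme_point_of_segment)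
  have "u extreme_point_of e" using extreme_point_of_face[OF face] assms by blast
  then have "u = a \<or> u = b" by (simp add: ab extreme_point_of_segment)
  then show ?thesis
    using that[of a] that[of b] ext \<open>a \<noteq> b\<close> ab closed_segment_commute by metis
qed

section \<open>Coordinates that separate 0/1-points\<close>

text \<open>If some vector of \<open>V\<close> is nonzero at \<open>j\<close>, intersecting
  \<open>V\<close> with the hyperplane of vectors vanishing at \<open>j\<close> lowers the
  dimension. Every chosen coordinate is thus paid for by one dimension.\<close>

lemma separating_coordinates:
  fixes V :: "(real ^ 'd) set"
  assumes "subspace V"
  obtains J where "card J \<le> dim V" "\<And>v. v \<in> V \<Longrightarrow> (\<And>j. j \<in> J \<Longrightarrow> v $ j = 0) \<Longrightarrow> v = 0"
proof -
  have "\<exists>J. card J \<le> dim V \<and> (\<forall>v\<in>V. (\<forall>j\<in>J. v $ j = 0) \<longrightarrow> v = 0)"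
    using assms
  proof (induction "dim V" arbitrary: V rule: less_induct)
    case less
    show ?case
    proof (cases "V \<subseteq> {0}")
      case True
      then show ?thesis by (intro exI[of _ "{}"]) auto
    next
      case False
      then obtain v where "v \<in> V" "v \<noteq> 0" by blast
      then obtain j where v: "v \<in> V" "v $ j \<noteq> 0" by (auto simp: vec_eq_iff)
      define W where "W = V \<inter> {x. x $ j = 0}"
      have W: "subspace W"
        unfolding W_def using less.prems by (intro subspace_inter) (auto simp: subspace_def)
      have "W \<subset> V" using v by (auto simp: W_def)
      then have "dim W < dim V"
        using W less.prems by (metis dim_psubset span_eq_iff)
      with less.hyps[OF this W] obtain J where J: "card J \<le> dim W"
          "\<forall>v\<in>W. (\<forall>j\<in>J. v $ j = 0) \<longrightarrow> v = 0"
        by blast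
      have "card (insert j J) \<le> dim V"
        using J(1) \<open>dim W < dim V\<close> card_insert_le_m1[of "dim V" J j] by simp
      moreover have "\<forall>v\<in>V. (\<forall>j\<in>insert j J. v $ j = 0) \<longrightarrow> v = 0"
        using J(2) by (auto simp: W_def)
      ultimately show ?thesis by blast
    qed
  qed
  then show ?thesis using that by blast
qed

definition support :: "real ^ 'd \<Rightarrow> 'd set"
  where "support x = {j. x $ j = 1}"

text \<open>Two points of \<open>V\<close> are distinguished by \<open>J\<close> if their difference
  does not vanish on \<open>J\<close>. The differences lie in \<open>span ?D\<close>, a linear space
  whose dimension is \<open>aff_dim V\<close>.\<close>

lemma support_separates:
  fixes V :: "(real ^ 'd) set"
  assumes "V \<subseteq> zero_one_cube" "aff_dim V \<le> int n"
  obtains J where "card J \<le> n" "inj_on (\<lambda>x. support x \<inter> J) V"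
proof (cases "V = {}")
  case True
  then show ?thesis using that[of "{}"] by simp
next
  case False
  then obtain a where a: "a \<in> V" by blast
  let ?D = "(\<lambda>x. x - a) ` V"
  have "aff_dim V = int (dim ?D)"
    using aff_dim_eq_dim_subtract[of a V] a hull_inc by fastforce
  then have dim: "dim (span ?D) \<le> n" using assms(2) by simp
  obtain J where J: "card J \<le> dim (span ?D)"
      "\<And>v. v \<in> span ?D \<Longrightarrow> (\<And>j. j \<in> J \<Longrightarrow> v $ j = 0) \<Longrightarrow> v = 0"
    using separating_coordinates[of "span ?D"] by auto
  have "inj_on (\<lambda>x. support x \<inter> J) V"
  proof (rule inj_onI)
    fix x y assume xy: "x \<in> V" "y \<in> V" "support x \<inter> J = support y \<inter> J"
    have "x $ j = y $ j" if "j \<in> J" for j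
    proof -
      have "x $ j \<in> {0, 1}" "y $ j \<in> {0, 1}"
        using xy assms(1) by (auto simp: zero_one_cube_def)
      moreover have "x $ j = 1 \<longleftrightarrow> y $ j = 1" using xy(3) that by (auto simp: support_def)
      ultimately show ?thesis by auto
    qed
    moreover have "x - y \<in> span ?D"
    proof -
      have "(x - a) - (y - a) \<in> span ?D" using xy by (intro span_diff span_base) auto
      then show ?thesis by simp
    qed
    ultimately have "x - y = 0" by (intro J(2)) auto
    then show "x = y" by simp
  qed
  with that J(1) dim show ?thesis by (meson le_trans)
qed

section \<open>Neighbours in 0/1-polytopes and the edge expansion\<close>

lemma coordinate_face:
  fixes P :: "(real ^ 'd) set"
  assumes "convex P" "P \<subseteq> {x. \<forall>i. 0 \<le> x $ i \<and> x $ i \<le> 1}" "c = 0 \<or> c = 1"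
  shows "P \<inter> {x. x $ k = c} face_of P"
  using assms(3)
proof
  assume "c = 0"
  have "P \<inter> {x. axis k 1 \<bullet> x = 0} face_of P"
    using assms by (intro face_of_Int_supporting_hyperplane_ge) (auto simp: inner_axis')
  then show ?thesis by (simp add: \<open>c = 0\<close> inner_axis')
next
  assume "c = 1"
  have "P \<inter> {x. axis k 1 \<bullet> x = 1} face_of P"
    using assms by (intro face_of_Int_supporting_hyperplane_le) (auto simp: inner_axis')
  then show ?thesis by (simp add: \<open>c = 1\<close> inner_axis')
qed

lemma finite_zero_one_cube: "finite (zero_one_cube :: (real ^ 'd) set)"
proof -
  have "inj_on support (zero_one_cube :: (real ^ 'd) set)"
  proof (rule inj_onI)
    fix x y :: "real ^ 'd"
    assume *: "x \<in> zero_one_cube" "y \<in> zero_one_cube" "support x = support y"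
    have "x $ j = y $ j" for j
    proof -
      have "x $ j \<in> {0, 1}" "y $ j \<in> {0, 1}" using * by (auto simp: zero_one_cube_def)
      moreover have "x $ j = 1 \<longleftrightarrow> y $ j = 1" using *(3) by (auto simp: support_def)
      ultimately show ?thesis by auto
    qed
    then show "x = y" by (simp add: vec_eq_iff)
  qed
  then show ?thesis by (rule inj_on_finite[of _ _ UNIV]) auto
qed

lemma zero_one_polytope_neighbour:
  fixes X :: "(real ^ 'd) set"
  defines "P \<equiv> convex hull X"
  assumes X: "X \<subseteq> zero_one_cube"
    and u: "u extreme_point_of P" and w: "w extreme_point_of P" and j: "u $ j \<noteq> w $ j"
  obtains v where "v extreme_point_of P" "closed_segment u v edge_of P"
    "\<And>k. u $ k = w $ k \<Longrightarrow> v $ k = u $ k" "v $ j = w $ j"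
proof -
  have vertex: "x $ k = 0 \<or> x $ k = 1" if "x extreme_point_of P" for x k
    using that X extreme_point_of_convex_hull[of x X] by (auto simp: P_def zero_one_cube_def)
  have "finite X" using X finite_zero_one_cube finite_subset by blast
  then have poly: "polytope P" unfolding P_def by (rule polytope_convex_hull)
  have "0 \<le> x $ k \<and> x $ k \<le> 1" if "x \<in> X" for x k
  proof -
    have "x $ k \<in> {0, 1}" using that X by (auto simp: zero_one_cube_def)
    then show ?thesis by auto
  qed
  then have "X \<subseteq> cbox 0 1" by (auto simp: mem_box_cart)
  then have "P \<subseteq> cbox 0 1" unfolding P_def by (intro hull_minimal) auto
  then have box: "P \<subseteq> {x. \<forall>i. 0 \<le> x $ i \<and> x $ i \<le> 1}" by (auto simp: mem_box_cart)
  have face: "P \<inter> {x. x $ k = u $ k} face_of P" for k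
    using poly box vertex[OF u] by (intro coordinate_face) (auto simp: polytope_imp_convex)
  \<comment> \<open>\<open>F\<close> is cut out of \<open>P\<close> by the smallest cube face
    containing \<open>u\<close> and \<open>w\<close>. Inserting \<open>P\<close> keeps the
    intersection inside \<open>P\<close> even if \<open>u\<close> and \<open>w\<close> differ in
    every coordinate.\<close>
  define F where "F = \<Inter>(insert P ((\<lambda>k. P \<inter> {x. x $ k = u $ k}) ` {k. u $ k = w $ k}))"
  define G where "G = F \<inter> {x. x $ j = u $ j}"
  have F: "F face_of P"
    unfolding F_def
  proof (rule face_of_Inter)
    fix T assume "T \<in> insert P ((\<lambda>k. P \<inter> {x. x $ k = u $ k}) ` {k. u $ k = w $ k})"
    then consider "T = P" | k where "T = P \<inter> {x. x $ k = u $ k}" by blast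
    then show "T face_of P"
      using face face_of_refl[OF polytope_imp_convex[OF poly]] by cases auto
  qed simp
  then have FP: "F \<subseteq> P" by (rule face_of_imp_subset)
  have uP: "u \<in> P" "w \<in> P" using u w by (auto simp: extreme_point_of_def)
  have "G = F \<inter> (P \<inter> {x. x $ j = u $ j})" using FP by (auto simp: G_def)
  then have "G face_of P" using F face face_of_Int by metis
  then have G: "G face_of F" using FP by (auto simp: G_def intro: face_of_subset)
  have uw: "u \<in> G" "w \<in> F" "w \<notin> G" using uP j by (auto simp: F_def G_def)
  have polyF: "polytope F" using poly F face_of_polytope_polytope by blast
  have uF: "u extreme_point_of F"
    using u uw extreme_point_of_face[OF F] by (auto simp: G_def)
  obtain e where e: "e edge_of F" "u \<in> e" "\<not> e \<subseteq> G"
    using edge_leaving_face[OF polyF G _ uF uw(1)] uw by metis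
  obtain v where v: "v extreme_point_of F" "e = closed_segment u v"
    using edge_eq_segment[OF polyF e(1) uF e(2)] by metis
  have vF: "v extreme_point_of P" "v \<in> F"
    using v(1) extreme_point_of_face[OF F] by auto
  \<comment> \<open>\<open>G\<close> is convex and contains \<open>u\<close>, so it would otherwise
    contain the whole edge. Hence \<open>v\<close> leaves the value \<open>u $ j\<close>, and among
    0 and 1 only \<open>w $ j\<close> remains.\<close>
  have "v \<notin> G"
    using e(3) v(2) uw(1) face_of_imp_convex[OF G] closed_segment_subset by blast
  then have "v $ j \<noteq> u $ j" using vF by (auto simp: G_def)
  then have "v $ j = w $ j" using vertex[OF u, of j] vertex[OF w, of j] vertex[OF vF(1), of j] j by auto
  moreover have "closed_segment u v edge_of P"
    using e(1) v(2) F by (auto simp: edge_of_def intro: face_of_trans)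
  moreover have "v $ k = u $ k" if "u $ k = w $ k" for k
  proof -
    have "v \<in> P \<inter> {x. x $ k = u $ k}" using vF(2) that unfolding F_def by blast
    then show ?thesis by simp
  qed
  ultimately show ?thesis using that vF by blast
qed

theorem theorem3:
  fixes X :: "(real ^ 'd) set"
  assumes "X \<subseteq> zero_one_cube"
    and "X \<noteq> {}"
    and "aff_dim (convex hull X) \<le> 5"
  shows "edge_expansion (polytope_graph (convex hull X)) \<ge> 1"
proof -
  define P where "P = convex hull X"
  define V where "V = {v. v extreme_point_of P}"
  interpret cube_graph support "\<lambda>u v. closed_segment u v edge_of P"
    by unfold_locales (simp add: closed_segment_commute)
  have VX: "V \<subseteq> X"
    using extreme_point_of_convex_hull by (auto simp: V_def P_def)
  then have V: "V \<subseteq> zero_one_cube" "finite V"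
    using assms(1) finite_zero_one_cube by (auto intro: finite_subset)
  have "V \<subseteq> P" using VX hull_subset[of X convex] by (auto simp: P_def)
  then have "aff_dim V \<le> int 5" using assms(3) aff_dim_subset[of V P] by (simp add: P_def)
  \<comment> \<open>The dimension bound enters only here, as the number of coordinates that identify
    the vertices.\<close>
  then obtain J where J: "card J \<le> 5" "inj_on (\<lambda>x. support x \<inter> J) V"
    using support_separates[OF V(1)] by metis
  have conn: "interval_connected V"
    unfolding interval_connected_def
  proof (intro ballI allI impI)
    fix u w j assume uw: "u \<in> V" "w \<in> V" "(j \<in> support u) \<noteq> (j \<in> support w)"
    then have ext: "u extreme_point_of convex hull X" "w extreme_point_of convex hull X"
        "u $ j \<noteq> w $ j"
      by (auto simp: V_def P_def support_def)
    obtain v where v: "v extreme_point_of convex hull X"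
        "closed_segment u v edge_of convex hull X"
        "\<And>k. u $ k = w $ k \<Longrightarrow> v $ k = u $ k" "v $ j = w $ j"
      using zero_one_polytope_neighbour[OF assms(1) ext] by blast
    then have "v \<in> V" by (simp add: V_def P_def)
    \<comment> \<open>Where \<open>u\<close> and \<open>w\<close> differ, they take both values 0
      and 1, so \<open>v\<close> agrees with one of them.\<close>
    have "v $ k = u $ k \<or> v $ k = w $ k" for k
    proof -
      have "x $ k \<in> {0, 1}" if "x \<in> V" for x
        using that V(1) by (auto simp: zero_one_cube_def)
      from this[OF uw(1)] this[OF uw(2)] this[OF \<open>v \<in> V\<close>] v(3)[of k] show ?thesis by auto
    qed
    then have "support v \<in> interval (support u) (support w)"
      unfolding interval_def support_def by (auto; metis)
    moreover have "(j \<in> support v) = (j \<in> support w)" using v(4) by (simp add: support_def)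
    ultimately show "\<exists>v\<in>V. closed_segment u v edge_of P \<and>
        support v \<in> interval (support u) (support w) \<and> (j \<in> support v) = (j \<in> support w)"
      using v(2) \<open>v \<in> V\<close> by (auto simp: P_def)
  qed
  have "1 \<le> ereal (real (card (edge_cut (polytope_graph P) S)) / real (card S))"
    if "S \<in> expansion_candidates (polytope_graph P)" for S
  proof -
    have S: "S \<subseteq> V" "S \<noteq> {}" "2 * card S \<le> card V"
      using that by (auto simp: expansion_candidates_def polytope_graph_def V_def)
    have finS: "finite S" using S V finite_subset by blast
    have "card V = card S + card (V - S)"
      using S V finS by (simp add: card_Diff_subset card_mono)
    then have "card S = min (card S) (card (V - S))" using S(3) by simp
    also have "\<dots> \<le> cut S (V - S)"
    proof (rule min_card_le_cut[OF finS _ _ _ _ J(1)])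
      have "S \<union> (V - S) = V" using S by blast
      then show "interval_connected (S \<union> (V - S))"
          "inj_on (\<lambda>x. support x \<inter> J) (S \<union> (V - S))"
        using conn J(2) by simp_all
    qed (use V in auto)
    also have "\<dots> \<le> card (edge_cut (polytope_graph P) S)"
      unfolding cut_def
    proof (rule card_inj_on_le)
      let ?E = "{(u, v) \<in> S \<times> (V - S). closed_segment u v edge_of P}"
      \<comment> \<open>An edge determines its ordered pair, because exactly one of its ends lies in
        \<open>S\<close>.\<close>
      show "inj_on (\<lambda>(u, v). {u, v}) ?E" by (auto simp: inj_on_def doubleton_eq_iff)
      show "(\<lambda>(u, v). {u, v}) ` ?E \<subseteq> edge_cut (polytope_graph P) S"
      proof (clarify)
        fix u v assume uv: "u \<in> S" "v \<in> V" "v \<notin> S" "closed_segment u v edge_of P"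
        then have "u extreme_point_of P" "v extreme_point_of P" "u \<noteq> v"
          using S(1) by (auto simp: V_def)
        with uv show "{u, v} \<in> edge_cut (polytope_graph P) S"
          unfolding edge_cut_def polytope_graph_def by auto
      qed
      have "edge_cut (polytope_graph P) S \<subseteq> edges (polytope_graph P)"
        by (auto simp: edge_cut_def)
      also have "\<dots> \<subseteq> Pow V" by (auto simp: polytope_graph_def V_def)
      finally show "finite (edge_cut (polytope_graph P) S)"
        using V(2) by (meson finite_Pow_iff finite_subset)
    qed
    finally show ?thesis
      using S(2) finS by (simp add: one_ereal_def card_gt_0_iff)
  qed
  then show ?thesis
    unfolding edge_expansion_def P_def by (intro INF_greatest)
qed

end
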